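(* Let $\alpha$ be a nonspecial collection of parabolic weights for degree $1$ and put $\epsilon_i=(\alpha_i^+-\alpha_i^-)/2$. Suppose one of the following three conditions holds: (a) $\epsilon_1+\epsilon_2+\epsilon_3+\epsilon_4<1/2$; (b) $\epsilon_1+\epsilon_2+\epsilon_3+\epsilon_4>3/2$; or (c) there exists a renumbering $\{1,2,3,4\}=\{i,j,k,l\}$ such that $\epsilon_i+\epsilon_j-\epsilon_k-\epsilon_l>1/2$. Then every parabolic structure $(B,P_\bullet)$ on the bundle $B=\mathcal O\oplus\mathcal O(1)$ on $\mathbb P^1$ is ($\alpha$-)unstable. If, on the contrary, none of these conditions holds, then a general parabolic structure on $B$ is ($\alpha$-)stable (although some special parabolic structures might still be unstable).
   Context: Work over $\mathbb C$; $t_1,\dots,t_4\in\mathbb P^1$ are four distinct points. A (quasi)parabolic structure on a rank 2 bundle $E$ on $\mathbb P^1$ is a choice of lines $P_i\subset E_{t_i}$, $i=1,\dots,4$; those on $B$ are parametrized by $\mathcal Q=\prod_i\mathbb P(B_{t_i})\cong(\mathbb P^1)^4$, and "general" means on a nonempty Zariski open subset of $\mathcal Q$. Weights: $\alpha=(\alpha_i^\pm)_{1\le i\le 4}$ real with $\alpha_i^-\le\alpha_i^+\le\alpha_i^-+1$; nonspecial for degree $d$ if $\alpha_i^-<\alpha_i^+<\alpha_i^-+1$ for all $i$ and $\sum_i\alpha_i^{\sigma_i}+\frac{d-\sum_i(\alpha_i^++\alpha_i^-)}2\notin\mathbb Z$ for all signs $\sigma_i\in\{+,-\}$. Here $\alpha_i^-$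 is attached to $P_i$ and $\alpha_i^+$ to $E_{t_i}/P_i$. Put $\deg^{\rm par}(E)=\deg E-\sum_i(\alpha_i^++\alpha_i^-)$, and for a line subbundle $F\subset E$, $\deg^{\rm par}(F)=\deg F-\sum_i\alpha_i^{\sigma(i,F)}$ with $\sigma(i,F)=-$ if $F_{t_i}=P_i$ and $+$ otherwise. $(E,P_\bullet)$ is $\alpha$-semistable (resp. $\alpha$-stable) if $\deg^{\rm par}(F)\le$ (resp. $<$) $\deg^{\rm par}(E)/2$ for every line subbundle $F\subset E$; unstable means not semistable. *)

theory Defs
  imports "HOL-Analysis.Analysis" "HOL-Computational_Algebra.Fundamental_Theorem_Algebra"
    "HOL-Computational_Algebra.Polynomial_Factorial" "HOL-Computational_Algebra.Field_as_Ring"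
begin

section \<open>Bundles of rank at most two on the complex projective line\<close>

text \<open>
  The projective line is glued from two affine lines, with coordinates \<open>z\<close> and \<open>w = 1 / z\<close>; the
  point \<open>Infty\<close> is \<open>w = 0\<close>.
  An algebraic vector bundle is trivial on either affine line, so it is given by its transition
  matrix over the overlap \<open>z \<noteq> 0\<close>.  Convention: the matrix (or, in rank one, the function) sends
  coordinates with respect to the frame over the \<open>w\<close>-line to coordinates with respect to the
  frame over the \<open>z\<close>-line.  Values at \<open>z = 0\<close> are irrelevant.
\<close>

datatype cp1 = Fin complex | Infty

text \<open>Regular functions on the overlap, i.e. Laurent polynomials in \<open>z\<close>.\<close>

definition laurent :: "(complex \<Rightarrow> complex) \<Rightarrow> bool" where
  "laurent g \<longleftrightarrow> (\<exists>p n. \<forall>z. z \<noteq> 0 \<longrightarrow> g z = poly p z / z ^ n)"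

definition line_bundle :: "(complex \<Rightarrow> complex) \<Rightarrow> bool" where
  "line_bundle g \<longleftrightarrow> laurent g \<and> (\<forall>z. z \<noteq> 0 \<longrightarrow> g z \<noteq> 0)"

type_synonym transition = "complex \<Rightarrow> complex ^ 2 ^ 2"

definition rank2_bundle :: "transition \<Rightarrow> bool" where
  "rank2_bundle E \<longleftrightarrow> (\<forall>i j. laurent (\<lambda>z. E z $ i $ j)) \<and> (\<forall>z. z \<noteq> 0 \<longrightarrow> det (E z) \<noteq> 0)"

text \<open>
  The nowhere vanishing Laurent polynomials are the monomials \<open>c z\<^sup>d\<close> with \<open>c \<noteq> 0\<close>, and such a
  transition function defines a line bundle of degree \<open>d\<close> (see \<open>O_line\<close>).
\<close>

definition line_degree :: "(complex \<Rightarrow> complex) \<Rightarrow> int" where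
  "line_degree g = (THE d. \<exists>c. c \<noteq> 0 \<and> (\<forall>z. z \<noteq> 0 \<longrightarrow> g z = c * z powi d))"

definition bundle_degree :: "transition \<Rightarrow> int" where
  "bundle_degree E = line_degree (\<lambda>z. det (E z))"

text \<open>
  \<open>O(n)\<close>: with homogeneous coordinates \<open>X, Y\<close> and \<open>z = X / Y\<close>, it has the frames \<open>Y\<^sup>n\<close> and
  \<open>X\<^sup>n = z\<^sup>n Y\<^sup>n\<close>.
\<close>

definition O_line :: "int \<Rightarrow> complex \<Rightarrow> complex" where
  "O_line n = (\<lambda>z. z powi n)"

definition direct_sum :: "(complex \<Rightarrow> complex) \<Rightarrow> (complex \<Rightarrow> complex) \<Rightarrow> transition" where
  "direct_sum g h = (\<lambda>z. vector [vector [g z, 0], vector [0, h z]])"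


section \<open>Line subbundles\<close>

text \<open>
  Every fibre is identified with \<open>complex ^ 2\<close>: over \<open>Fin z\<close> by the frame on the \<open>z\<close>-line, over
  \<open>Infty\<close> by the frame on the \<open>w\<close>-line.  A line subbundle is the family \<open>F\<close> of its fibres;
  over each affine line it is spanned by a nowhere vanishing polynomial section
  (line bundles on the affine line being trivial).
\<close>

definition poly_vec :: "complex poly ^ 2 \<Rightarrow> complex \<Rightarrow> complex ^ 2" where
  "poly_vec s z = (\<chi> k. poly (s $ k) z)"

definition subbundle_frames ::
    "transition \<Rightarrow> (cp1 \<Rightarrow> (complex ^ 2) set) \<Rightarrow> complex poly ^ 2 \<Rightarrow> complex poly ^ 2 \<Rightarrow> bool" where
  "subbundle_frames E F s\<^sub>0 s\<^sub>1 \<longleftrightarrow>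
     (\<forall>z. poly_vec s\<^sub>0 z \<noteq> 0 \<and> F (Fin z) = vec.span {poly_vec s\<^sub>0 z}) \<and>
     (\<forall>w. poly_vec s\<^sub>1 w \<noteq> 0) \<and> F Infty = vec.span {poly_vec s\<^sub>1 0} \<and>
     (\<forall>w. w \<noteq> 0 \<longrightarrow> F (Fin (1 / w)) = vec.span {E (1 / w) *v poly_vec s\<^sub>1 w})"

definition line_subbundle :: "transition \<Rightarrow> (cp1 \<Rightarrow> (complex ^ 2) set) \<Rightarrow> bool" where
  "line_subbundle E F \<longleftrightarrow> (\<exists>s\<^sub>0 s\<^sub>1. subbundle_frames E F s\<^sub>0 s\<^sub>1)"

text \<open>\<open>g\<close> is the transition function of the line bundle \<open>F\<close> for some choice of frames.\<close>

definition subbundle_transition ::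
    "transition \<Rightarrow> (cp1 \<Rightarrow> (complex ^ 2) set) \<Rightarrow> (complex \<Rightarrow> complex) \<Rightarrow> bool" where
  "subbundle_transition E F g \<longleftrightarrow>
     (\<exists>s\<^sub>0 s\<^sub>1. subbundle_frames E F s\<^sub>0 s\<^sub>1 \<and>
        (\<forall>z. z \<noteq> 0 \<longrightarrow> E z *v poly_vec s\<^sub>1 (1 / z) = g z *s poly_vec s\<^sub>0 z))"

definition subbundle_degree :: "transition \<Rightarrow> (cp1 \<Rightarrow> (complex ^ 2) set) \<Rightarrow> int" where
  "subbundle_degree E F = (THE d. \<exists>g. subbundle_transition E F g \<and> d = line_degree g)"

text \<open>The degree of a line subbundle does not depend on the choice of frames.\<close>

lemma line_degree_eqI:
  assumes "c \<noteq> 0" "\<And>z. z \<noteq> 0 \<Longrightarrow> g z = c * z powi d"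
  shows "line_degree g = d"
  unfolding line_degree_def
proof (rule the_equality)
  show "\<exists>c. c \<noteq> 0 \<and> (\<forall>z. z \<noteq> 0 \<longrightarrow> g z = c * z powi d)"
    using assms by blast
next
  fix e assume "\<exists>c. c \<noteq> 0 \<and> (\<forall>z. z \<noteq> 0 \<longrightarrow> g z = c * z powi e)"
  then obtain b where b: "\<And>z. z \<noteq> 0 \<Longrightarrow> g z = b * z powi e" by blast
  have "b = c" using b[of 1] assms(2)[of 1] by simp
  then have "(2::complex) powi e = 2 powi d" using b[of 2] assms by simp
  then have "norm ((2::complex) powi e) = norm ((2::complex) powi d)" by simp
  then have "(2::real) powi e = 2 powi d" by (simp only: norm_power_int norm_numeral)
  then show "e = d"
    using power_int_strict_increasing[of d e "2::real"] power_int_strict_increasing[of e d "2::real"]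
    by (cases d e rule: linorder_cases) auto
qed

lemma poly_nonvanishing_const:
  fixes p :: "complex poly"
  assumes "\<And>z. poly p z \<noteq> 0"
  obtains c where "c \<noteq> 0" "p = [:c:]"
proof -
  have "degree p = 0"
    using assms fundamental_theorem_of_algebra constant_degree by blast
  then obtain c where "p = [:c:]" using degree_eq_zeroE by blast
  then show thesis using that assms[of 0] by auto
qed

lemma line_bundle_monomial:
  assumes "line_bundle g"
  obtains c d where "c \<noteq> 0" "\<And>z. z \<noteq> 0 \<Longrightarrow> g z = c * z powi d"
proof -
  obtain p n where g: "\<And>z. z \<noteq> 0 \<Longrightarrow> g z = poly p z / z ^ n"
    using assms unfolding line_bundle_def laurent_def by blast
  have nz: "poly p z \<noteq> 0" if "z \<noteq> 0" for z
    using assms g that unfolding line_bundle_def by fastforce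
  have "p \<noteq> 0" using nz[of 1] by auto
  then obtain q where q: "p = [:-0, 1:] ^ order 0 p * q" "\<not> [:-0, 1:] dvd q"
    using order_decomp by blast
  have "poly q z \<noteq> 0" for z
  proof (cases "z = 0")
    case True
    then show ?thesis using q(2) poly_eq_0_iff_dvd by blast
  next
    case False
    then show ?thesis using nz[of z] q(1) by (metis mult_zero_right poly_mult)
  qed
  then obtain c where c: "c \<noteq> 0" "q = [:c:]" using poly_nonvanishing_const by blast
  define m where "m = order 0 p"
  have "p = [:0, 1:] ^ m * [:c:]" using q(1) c(2) m_def by simp
  then have "g z = c * z powi (int m - int n)" if "z \<noteq> 0" for z
    using g[OF that] that by (simp add: poly_power power_int_diff)
  then show thesis using that c(1) by blast
qed

lemma laurent_poly: "laurent (poly p)"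
  unfolding laurent_def by (rule exI[of _ p], rule exI[of _ 0]) simp

lemma laurent_0: "laurent (\<lambda>z. 0)"
  unfolding laurent_def by (rule exI[of _ 0], rule exI[of _ 0]) simp

lemma laurent_mult: "laurent f \<Longrightarrow> laurent g \<Longrightarrow> laurent (\<lambda>z. f z * g z)"
proof -
  assume "laurent f" "laurent g"
  then obtain p n q m where "\<And>z. z \<noteq> 0 \<Longrightarrow> f z = poly p z / z ^ n"
    "\<And>z. z \<noteq> 0 \<Longrightarrow> g z = poly q z / z ^ m" unfolding laurent_def by metis
  then show ?thesis unfolding laurent_def
    by (intro exI[of _ "p * q"] exI[of _ "n + m"]) (simp add: power_add)
qed

lemma laurent_add: "laurent f \<Longrightarrow> laurent g \<Longrightarrow> laurent (\<lambda>z. f z + g z)"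
proof -
  assume "laurent f" "laurent g"
  then obtain p n q m where "\<And>z. z \<noteq> 0 \<Longrightarrow> f z = poly p z / z ^ n"
    "\<And>z. z \<noteq> 0 \<Longrightarrow> g z = poly q z / z ^ m" unfolding laurent_def by metis
  then show ?thesis unfolding laurent_def
    by (intro exI[of _ "p * monom 1 m + q * monom 1 n"] exI[of _ "n + m"])
      (simp add: power_add poly_monom field_simps)
qed

lemma laurent_poly_inverse: "laurent (\<lambda>z. poly p (1 / z))"
proof (induction p)
  case 0
  then show ?case by (simp add: laurent_0)
next
  case (pCons a p)
  have "laurent (\<lambda>z. 1 / z)"
    unfolding laurent_def by (rule exI[of _ 1], rule exI[of _ 1]) simp
  then show ?case
    using laurent_add[OF laurent_poly[of "[:a:]"] laurent_mult[OF \<open>laurent (\<lambda>z. 1 / z)\<close> pCons.IH]]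
    by simp
qed

lemma nonvanishing_bezout:
  assumes "\<And>z. poly_vec s z \<noteq> 0"
  obtains a b where "\<And>z. poly a z * poly (s $ 1) z + poly b z * poly (s $ 2) z = 1"
proof -
  define h where "h = gcd (s $ 1) (s $ 2)"
  have "poly h z \<noteq> 0" for z
  proof
    assume "poly h z = 0"
    moreover have "h dvd s $ 1" "h dvd s $ 2" by (simp_all add: h_def)
    ultimately have "poly (s $ 1) z = 0" "poly (s $ 2) z = 0" by (auto elim!: dvdE)
    then show False using assms[of z] by (simp add: poly_vec_def vec_eq_iff forall_2)
  qed
  then obtain c where c: "c \<noteq> 0" "h = [:c:]" using poly_nonvanishing_const by blast
  define u v where "u = fst (bezout_coefficients (s $ 1) (s $ 2))"
    and "v = snd (bezout_coefficients (s $ 1) (s $ 2))"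
  have uv: "u * (s $ 1) + v * (s $ 2) = h"
    unfolding u_def v_def h_def by (rule bezout_coefficients_fst_snd)
  have "poly u z * poly (s $ 1) z + poly v z * poly (s $ 2) z = c" for z
    using arg_cong[OF uv, of "\<lambda>p. poly p z"] c(2) by simp
  then have "poly (smult (1 / c) u) z * poly (s $ 1) z + poly (smult (1 / c) v) z * poly (s $ 2) z = 1" for z
    using c(1) by (simp add: field_simps)
  then show thesis using that by blast
qed

lemma span_singleton_eq:
  fixes x y :: "complex ^ 2"
  assumes "vec.span {x} = vec.span {y}" "x \<noteq> 0"
  obtains c where "c \<noteq> 0" "x = c *s y"
proof -
  have "x \<in> vec.span {y}" using assms(1) vec.span_base by blast
  then obtain c where "x = c *s y" by (auto simp: vec.span_singleton)
  then show thesis using that assms(2) by (cases "c = 0") auto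
qed

lemma span_singleton_scale:
  fixes x :: "complex ^ 2"
  assumes "b \<noteq> 0"
  shows "vec.span {b *s x} = vec.span {x}"
proof -
  have "k *s x = (k / b) *s (b *s x)" for k using assms by simp
  then have "k *s x \<in> range (\<lambda>k. k *s (b *s x))" for k by blast
  moreover have "k *s (b *s x) \<in> range (\<lambda>k. k *s x)" for k
    by (rule range_eqI[of _ _ "k * b"]) (simp add: vector_smult_assoc)
  ultimately have "range (\<lambda>k. k *s (b *s x)) = range (\<lambda>k. k *s x)" by blast
  then show ?thesis by (simp only: vec.span_singleton)
qed

lemma frame_unique:
  assumes "\<And>z. poly_vec s z \<noteq> 0" "\<And>z. poly_vec r z \<noteq> 0"
    and "\<And>z. vec.span {poly_vec r z} = vec.span {poly_vec s z}"
  obtains c where "c \<noteq> 0" "\<And>z. poly_vec r z = c *s poly_vec s z"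
proof -
  obtain a b where ab: "\<And>z. poly a z * poly (s $ 1) z + poly b z * poly (s $ 2) z = 1"
    using nonvanishing_bezout assms(1) by blast
  define u where "u = a * (r $ 1) + b * (r $ 2)"
  have u: "poly u z \<noteq> 0 \<and> poly_vec r z = poly u z *s poly_vec s z" for z
  proof -
    obtain c where c: "c \<noteq> 0" "poly_vec r z = c *s poly_vec s z"
      using span_singleton_eq[OF assms(3,2)] by blast
    have "poly (r $ k) z = c * poly (s $ k) z" for k
      using arg_cong[OF c(2), of "\<lambda>x. x $ k"] by (simp add: poly_vec_def)
    then have "poly u z = c * (poly a z * poly (s $ 1) z + poly b z * poly (s $ 2) z)"
      unfolding u_def by (simp add: algebra_simps)
    then show ?thesis using ab c by simp
  qed
  then obtain c where "c \<noteq> 0" "u = [:c:]" using poly_nonvanishing_const by blast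
  then show thesis using that u by simp
qed

lemma subbundle_transition_exists:
  assumes "rank2_bundle E" "line_subbundle E F"
  shows "\<exists>g. subbundle_transition E F g"
proof -
  obtain r s where rs: "subbundle_frames E F r s"
    using assms(2) unfolding line_subbundle_def by blast
  have "\<exists>c. E z *v poly_vec s (1 / z) = c *s poly_vec r z" if "z \<noteq> 0" for z
  proof -
    have "\<And>w. w \<noteq> 0 \<Longrightarrow> F (Fin (1 / w)) = vec.span {E (1 / w) *v poly_vec s w}"
      and F: "F (Fin z) = vec.span {poly_vec r z}"
      using rs unfolding subbundle_frames_def by auto
    from this(1)[of "1 / z"] that
    have "vec.span {E z *v poly_vec s (1 / z)} = vec.span {poly_vec r z}" by (simp add: F)
    then have "E z *v poly_vec s (1 / z) \<in> vec.span {poly_vec r z}"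
      using vec.span_base by blast
    then show ?thesis by (auto simp: vec.span_singleton)
  qed
  then obtain g where "\<And>z. z \<noteq> 0 \<Longrightarrow> E z *v poly_vec s (1 / z) = g z *s poly_vec r z"
    by metis
  then show ?thesis using rs unfolding subbundle_transition_def by blast
qed

lemma subbundle_transition_line_bundle:
  assumes E: "rank2_bundle E" and g: "subbundle_transition E F g"
  shows "line_bundle g"
proof -
  obtain r s where rs: "subbundle_frames E F r s"
      "\<And>z. z \<noteq> 0 \<Longrightarrow> E z *v poly_vec s (1 / z) = g z *s poly_vec r z"
    using g unfolding subbundle_transition_def by blast
  obtain a b where ab: "\<And>z. poly a z * poly (r $ 1) z + poly b z * poly (r $ 2) z = 1"
  proof -
    have "\<And>z. poly_vec r z \<noteq> 0" using rs(1) unfolding subbundle_frames_def by blast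
    from nonvanishing_bezout[OF this] show ?thesis using that by blast
  qed
  define e where "e k z = E z $ k $ 1 * poly (s $ 1) (1 / z) + E z $ k $ 2 * poly (s $ 2) (1 / z)" for k z
  have E': "laurent (\<lambda>z. E z $ i $ j)" for i j
    using E unfolding rank2_bundle_def by blast
  have le: "laurent (e k)" for k
  proof -
    have "e k = (\<lambda>z. E z $ k $ 1 * poly (s $ 1) (1 / z) + E z $ k $ 2 * poly (s $ 2) (1 / z))"
      by (rule ext) (rule e_def)
    then show ?thesis
      using laurent_add[OF laurent_mult[OF E'[of k 1] laurent_poly_inverse[of "s $ 1"]]
          laurent_mult[OF E'[of k 2] laurent_poly_inverse[of "s $ 2"]]] by (simp only:)
  qed
  have ek: "e k z = g z * poly (r $ k) z" if "z \<noteq> 0" for k z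
    using arg_cong[OF rs(2)[OF that], of "\<lambda>x. x $ k"]
    by (simp add: e_def poly_vec_def matrix_vector_mult_def sum_2)
  have gz: "g z = poly a z * e 1 z + poly b z * e 2 z" if "z \<noteq> 0" for z
  proof -
    have "poly a z * e 1 z + poly b z * e 2 z
        = g z * (poly a z * poly (r $ 1) z + poly b z * poly (r $ 2) z)"
      by (simp add: ek[OF that] algebra_simps)
    then show ?thesis using ab by simp
  qed
  have "laurent (\<lambda>z. poly a z * e 1 z + poly b z * e 2 z)"
    by (rule laurent_add[OF laurent_mult[OF laurent_poly le] laurent_mult[OF laurent_poly le]])
  then obtain p n where "\<And>z. z \<noteq> 0 \<Longrightarrow> poly a z * e 1 z + poly b z * e 2 z = poly p z / z ^ n"
    unfolding laurent_def by blast
  then have "laurent g" unfolding laurent_def using gz by metis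
  moreover have "g z \<noteq> 0" if "z \<noteq> 0" for z
  proof
    assume "g z = 0"
    then have "E z *v poly_vec s (1 / z) = 0" using rs(2) that by simp
    moreover have "invertible (E z)"
      using E that unfolding rank2_bundle_def by (simp add: invertible_det_nz)
    then obtain A where "A ** E z = mat 1" unfolding invertible_def by blast
    then have "A *v (E z *v poly_vec s (1 / z)) = poly_vec s (1 / z)"
      by (simp add: matrix_vector_mul_assoc)
    ultimately have "poly_vec s (1 / z) = 0" by simp
    then show False using rs(1) unfolding subbundle_frames_def by blast
  qed
  ultimately show ?thesis unfolding line_bundle_def by blast
qed

lemma subbundle_degree_eq:
  assumes E: "rank2_bundle E" and g: "subbundle_transition E F g"
  shows "subbundle_degree E F = line_degree g"
  unfolding subbundle_degree_def
proof (rule the_equality)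
  show "\<exists>h. subbundle_transition E F h \<and> line_degree g = line_degree h" using g by blast
next
  fix d assume "\<exists>h. subbundle_transition E F h \<and> d = line_degree h"
  then obtain h where h: "subbundle_transition E F h" "d = line_degree h" by blast
  obtain r s where rs: "subbundle_frames E F r s"
      "\<And>z. z \<noteq> 0 \<Longrightarrow> E z *v poly_vec s (1 / z) = g z *s poly_vec r z"
    using g unfolding subbundle_transition_def by blast
  obtain r' s' where rs': "subbundle_frames E F r' s'"
      "\<And>z. z \<noteq> 0 \<Longrightarrow> E z *v poly_vec s' (1 / z) = h z *s poly_vec r' z"
    using h(1) unfolding subbundle_transition_def by blast
  have r: "vec.span {poly_vec r' z} = vec.span {poly_vec r z}" "poly_vec r z \<noteq> 0" "poly_vec r' z \<noteq> 0"
    "poly_vec s z \<noteq> 0" "poly_vec s' z \<noteq> 0" for z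
    using rs(1) rs'(1) unfolding subbundle_frames_def by auto
  obtain c where c: "c \<noteq> 0" "\<And>z. poly_vec r' z = c *s poly_vec r z"
    using frame_unique[OF r(2,3,1)] by blast
  have s: "vec.span {poly_vec s' w} = vec.span {poly_vec s w}" for w
  proof (cases "w = 0")
    case True
    then show ?thesis using rs(1) rs'(1) unfolding subbundle_frames_def by auto
  next
    case False
    let ?A = "E (1 / w)"
    have inv: "invertible ?A"
      using E False unfolding rank2_bundle_def by (simp add: invertible_det_nz)
    then obtain A' where A': "A' ** ?A = mat 1" unfolding invertible_def by blast
    have "F (Fin (1 / w)) = vec.span {?A *v poly_vec s w}"
      using rs(1) False unfolding subbundle_frames_def by blast
    moreover have "F (Fin (1 / w)) = vec.span {?A *v poly_vec s' w}"
      using rs'(1) False unfolding subbundle_frames_def by blast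
    ultimately have eq: "vec.span {?A *v poly_vec s' w} = vec.span {?A *v poly_vec s w}" by simp
    have A's: "A' *v (?A *v x) = x" for x
      using A' by (simp add: matrix_vector_mul_assoc)
    have "?A *v poly_vec s' w \<noteq> 0"
      using A's[of "poly_vec s' w"] r(5)[of w] by fastforce
    then obtain b where b: "b \<noteq> 0" "?A *v poly_vec s' w = b *s (?A *v poly_vec s w)"
      using span_singleton_eq eq by blast
    have "poly_vec s' w = b *s poly_vec s w"
      using arg_cong[OF b(2), of "(*v) A'"] by (simp add: A's vector_scalar_commute)
    then show ?thesis using b(1) span_singleton_scale by metis
  qed
  obtain b where b: "b \<noteq> 0" "\<And>z. poly_vec s' z = b *s poly_vec s z"
    using frame_unique[OF r(4,5) s] by blast
  have hg: "h z = (b / c) * g z" if "z \<noteq> 0" for z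
  proof -
    have "(h z * c) *s poly_vec r z = (b * g z) *s poly_vec r z"
      using rs(2)[OF that] rs'(2)[OF that] b(2) c(2) by (auto simp: vector_scalar_commute)
    then have "h z * c = b * g z" using r(2) by (simp add: vec.scale_right_imp_eq)
    then show ?thesis using c(1) by (simp add: field_simps)
  qed
  obtain k d' where k: "k \<noteq> 0" "\<And>z. z \<noteq> 0 \<Longrightarrow> g z = k * z powi d'"
    using line_bundle_monomial subbundle_transition_line_bundle[OF E g] by blast
  have "line_degree g = d'" using k by (rule line_degree_eqI)
  moreover have "line_degree h = d'"
    by (rule line_degree_eqI[of "b / c * k"]) (use k hg b c in auto)
  ultimately show "d = line_degree g" using h(2) by simp
qed

lemma laurent_powi: "laurent (\<lambda>z. z powi n)"
proof (cases "n \<ge> 0")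
  case True
  then show ?thesis unfolding laurent_def
    by (intro exI[of _ "monom 1 (nat n)"] exI[of _ 0]) (simp add: poly_monom power_int_def)
next
  case False
  then show ?thesis unfolding laurent_def
    by (intro exI[of _ 1] exI[of _ "nat (- n)"]) (simp add: power_int_def field_simps)
qed

lemma det_direct_sum: "det (direct_sum g h z) = g z * h z"
  by (simp add: direct_sum_def det_2)

lemma rank2_bundle_direct_sum: "rank2_bundle (direct_sum (O_line a) (O_line b))"
proof -
  have "laurent (\<lambda>z. direct_sum (O_line a) (O_line b) z $ i $ j)" for i j
    using laurent_powi[of a] laurent_powi[of b] laurent_0 exhaust_2[of i] exhaust_2[of j]
    by (auto simp: direct_sum_def O_line_def)
  then show ?thesis unfolding rank2_bundle_def by (simp add: det_direct_sum O_line_def)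
qed

lemma bundle_degree_direct_sum: "bundle_degree (direct_sum (O_line a) (O_line b)) = a + b"
  unfolding bundle_degree_def
  by (rule line_degree_eqI[of 1]) (auto simp: det_direct_sum O_line_def power_int_add)



section \<open>Parabolic structures and stability\<close>

definition lines :: "(complex ^ 2) set set" where
  "lines = {L. vec.subspace L \<and> vec.dim L = 1}"

text \<open>
  The product \<open>\<Prod>\<^sub>i \<P>(E\<^sub>t\<^sub>i)\<close> of the projectivised fibres at the four marked points; because
  of the identification of all the fibres with \<open>complex ^ 2\<close>, neither the bundle nor the points
  occur as arguments.
\<close>

definition parabolic_structures :: "(4 \<Rightarrow> (complex ^ 2) set) set" where
  "parabolic_structures = {P. \<forall>i. P i \<in> lines}"

datatype sign = Minus | Plus

type_synonym weights = "4 \<Rightarrow> sign \<Rightarrow> real"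

definition nonspecial :: "int \<Rightarrow> weights \<Rightarrow> bool" where
  "nonspecial d \<alpha> \<longleftrightarrow>
     (\<forall>i. \<alpha> i Minus < \<alpha> i Plus \<and> \<alpha> i Plus < \<alpha> i Minus + 1) \<and>
     (\<forall>\<sigma> :: 4 \<Rightarrow> sign.
        (\<Sum>i\<in>UNIV. \<alpha> i (\<sigma> i)) + (real_of_int d - (\<Sum>i\<in>UNIV. \<alpha> i Plus + \<alpha> i Minus)) / 2 \<notin> \<int>)"

definition pardeg :: "weights \<Rightarrow> transition \<Rightarrow> real" where
  "pardeg \<alpha> E = real_of_int (bundle_degree E) - (\<Sum>i\<in>UNIV. \<alpha> i Plus + \<alpha> i Minus)"

definition incidence_sign ::
    "(4 \<Rightarrow> cp1) \<Rightarrow> (4 \<Rightarrow> (complex ^ 2) set) \<Rightarrow> (cp1 \<Rightarrow> (complex ^ 2) set) \<Rightarrow> 4 \<Rightarrow> sign" where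
  "incidence_sign t P F i = (if F (t i) = P i then Minus else Plus)"

definition sub_pardeg ::
    "weights \<Rightarrow> (4 \<Rightarrow> cp1) \<Rightarrow> transition \<Rightarrow> (4 \<Rightarrow> (complex ^ 2) set) \<Rightarrow>
     (cp1 \<Rightarrow> (complex ^ 2) set) \<Rightarrow> real" where
  "sub_pardeg \<alpha> t E P F =
     real_of_int (subbundle_degree E F) - (\<Sum>i\<in>UNIV. \<alpha> i (incidence_sign t P F i))"

definition parabolic_semistable ::
    "weights \<Rightarrow> (4 \<Rightarrow> cp1) \<Rightarrow> transition \<Rightarrow> (4 \<Rightarrow> (complex ^ 2) set) \<Rightarrow> bool" where
  "parabolic_semistable \<alpha> t E P \<longleftrightarrow> (\<forall>F. line_subbundle E F \<longrightarrow> sub_pardeg \<alpha> t E P F \<le> pardeg \<alpha> E / 2)"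

definition parabolic_stable ::
    "weights \<Rightarrow> (4 \<Rightarrow> cp1) \<Rightarrow> transition \<Rightarrow> (4 \<Rightarrow> (complex ^ 2) set) \<Rightarrow> bool" where
  "parabolic_stable \<alpha> t E P \<longleftrightarrow> (\<forall>F. line_subbundle E F \<longrightarrow> sub_pardeg \<alpha> t E P F < pardeg \<alpha> E / 2)"

abbreviation parabolic_unstable ::
    "weights \<Rightarrow> (4 \<Rightarrow> cp1) \<Rightarrow> transition \<Rightarrow> (4 \<Rightarrow> (complex ^ 2) set) \<Rightarrow> bool" where
  "parabolic_unstable \<alpha> t E P \<equiv> \<not> parabolic_semistable \<alpha> t E P"


section \<open>The Zariski topology on the space of parabolic structures\<close>

inductive polynomial_fun :: "((4 \<Rightarrow> complex ^ 2) \<Rightarrow> complex) \<Rightarrow> bool" where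
  const: "polynomial_fun (\<lambda>v. c)"
| coord: "polynomial_fun (\<lambda>v. v i $ k)"
| add: "polynomial_fun p \<Longrightarrow> polynomial_fun q \<Longrightarrow> polynomial_fun (\<lambda>v. p v + q v)"
| mult: "polynomial_fun p \<Longrightarrow> polynomial_fun q \<Longrightarrow> polynomial_fun (\<lambda>v. p v * q v)"

definition multihomogeneous :: "((4 \<Rightarrow> complex ^ 2) \<Rightarrow> complex) \<Rightarrow> bool" where
  "multihomogeneous p \<longleftrightarrow>
     (\<exists>d :: 4 \<Rightarrow> nat. \<forall>c v. p (\<lambda>i. c i *s v i) = (\<Prod>i\<in>UNIV. c i ^ d i) * p v)"

definition zero_locus ::
    "((4 \<Rightarrow> complex ^ 2) \<Rightarrow> complex) set \<Rightarrow> (4 \<Rightarrow> (complex ^ 2) set) set" where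
  "zero_locus S =
     {P \<in> parabolic_structures. \<forall>p\<in>S. \<forall>v. (\<forall>i. v i \<in> P i - {0}) \<longrightarrow> p v = 0}"

definition zariski_open :: "(4 \<Rightarrow> (complex ^ 2) set) set \<Rightarrow> bool" where
  "zariski_open U \<longleftrightarrow>
     (\<exists>S. (\<forall>p\<in>S. polynomial_fun p \<and> multihomogeneous p) \<and> U = parabolic_structures - zero_locus S)"

definition holds_generally :: "((4 \<Rightarrow> (complex ^ 2) set) \<Rightarrow> bool) \<Rightarrow> bool" where
  "holds_generally A \<longleftrightarrow> (\<exists>U. zariski_open U \<and> U \<noteq> {} \<and> (\<forall>P\<in>U. A P))"

end

theory Submission
  imports Defs
begin

text \<open>
  A line subbundle \<open>F\<close> of degree \<open>1 - N\<close> satisfies the stability inequality iff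
  \<open>1 - N + (\<Sum>i\<in>I. \<epsilon> i) - (\<Sum>i\<notin>I. \<epsilon> i) < 1 / 2\<close>, where \<open>I\<close> is the set of \<open>i\<close> with \<open>F (t i) = P i\<close>.
  Maps from \<open>O(1 - N)\<close> to \<open>B\<close> form a space of dimension \<open>2 N + 1\<close>, so a nonzero one can be made to
  pass through any \<open>2 N\<close> of the lines \<open>P i\<close>.  Saturating its image does not decrease the left-hand
  side, because every zero raises the degree by one and costs at most one incidence, that is
  \<open>2 \<epsilon> i < 1\<close>.  The cases \<open>N = 0, 2, 1\<close> give a destabilising subbundle under (a), (b), (c).
  Conversely, for general \<open>P\<close> a subbundle of degree \<open>1\<close> or \<open>0\<close> meets at most \<open>0\<close> or \<open>2\<close> of the lines,
  in degrees \<open>\<le> -2\<close> nothing can destabilise since \<open>(\<Sum>i. \<epsilon> i) < 2\<close>, and nonspeciality excludes the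
  equality cases.
\<close>

section \<open>Maps from line bundles and line subbundles\<close>

text \<open>
  Homomorphisms from \<open>O(1 - N)\<close> to \<open>O \<oplus> O(1)\<close>: pairs of binary forms of degrees \<open>N - 1\<close> and \<open>N\<close>,
  dehomogenised.  For \<open>N = 0\<close> the first form is zero, so the truncated \<open>N - 1\<close> below is harmless.
\<close>

definition sections :: "nat \<Rightarrow> (complex poly \<times> complex poly) set" where
  "sections N = {(p, q). (p = 0 \<or> degree p < N) \<and> degree q \<le> N}"

text \<open>The value at \<open>Infty\<close> refers to the frame over the \<open>w\<close>-line: it
  consists of the values at \<open>w = 0\<close> of the reversed forms, i.e. their top coefficients.
  For \<open>N = 0\<close> the first entry reads \<open>coeff p 0\<close>, which is 0 on
  \<open>sections 0\<close>.\<close>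

fun section_value :: "nat \<Rightarrow> complex poly \<Rightarrow> complex poly \<Rightarrow> cp1 \<Rightarrow> complex ^ 2" where
  "section_value N p q (Fin z) = vector [poly p z, poly q z]"
| "section_value N p q Infty = vector [coeff p (N - 1), coeff q N]"

abbreviation O_plus_O1 :: transition where
  "O_plus_O1 \<equiv> direct_sum (O_line 0) (O_line 1)"

lemma vec2_eq_iff: "v = w \<longleftrightarrow> v $ 1 = w $ 1 \<and> v $ 2 = w $ 2" for v w :: "complex ^ 2"
  by (simp add: vec_eq_iff forall_2)

lemma O_plus_O1_mult:
  "O_plus_O1 z *v v = vector [v $ 1, z * v $ 2]"
  by (simp add: vec2_eq_iff matrix_vector_mult_def sum_2 direct_sum_def O_line_def)

text \<open>The form of degree \<open>n\<close> read in the coordinate \<open>w = 1 / z\<close>.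
  Since \<open>reflect_poly\<close> reverses with respect to the actual degree, the monomial
  restores the zero at infinity of order \<open>n - degree p\<close>.\<close>

definition reverse_poly :: "nat \<Rightarrow> complex poly \<Rightarrow> complex poly" where
  "reverse_poly n p = monom 1 (n - degree p) * reflect_poly p"

lemma poly_reverse_poly:
  assumes "degree p \<le> n" "w \<noteq> 0"
  shows "poly (reverse_poly n p) w = w ^ n * poly p (1 / w)"
proof -
  have "w ^ n = w ^ (n - degree p) * w ^ degree p"
    using assms(1) by (simp flip: power_add)
  then show ?thesis
    using assms(2)
    by (simp add: reverse_poly_def poly_monom poly_reflect_poly_nz field_simps)
qed

lemma poly_reverse_poly_0:
  assumes "degree p \<le> n"
  shows "poly (reverse_poly n p) 0 = coeff p n"
proof (cases "degree p = n")
  case True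
  then show ?thesis by (auto simp: reverse_poly_def poly_monom)
next
  case False
  then show ?thesis using assms
    by (simp add: reverse_poly_def poly_monom coeff_eq_0)
qed

lemma poly_eqI_nonzero:
  fixes p q :: "complex poly"
  assumes "\<And>z. z \<noteq> 0 \<Longrightarrow> poly p z = poly q z"
  shows "p = q"
proof -
  \<comment> \<open>Multiplication by the variable makes both sides agree at 0 as well, and it can
    be cancelled.\<close>
  have "[:0, 1:] * p = [:0, 1:] * q"
    unfolding poly_eq_poly_eq_iff[symmetric] using assms by (intro ext) auto
  then show ?thesis by (metis mult_cancel_left pCons_eq_0_iff zero_neq_one)
qed

text \<open>The pair is the frame over the \<open>z\<close>-line and its reversal the frame over the
  \<open>w\<close>-line. The extra factor \<open>z\<close> in the second coordinate compensates the
  larger form degree there, so both coordinates change by \<open>z powi (1 - int N)\<close>.\<close>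

lemma section_subbundle:
  assumes pq: "(p, q) \<in> sections N" and nz: "\<And>t. section_value N p q t \<noteq> 0"
  defines "F \<equiv> \<lambda>t. vec.span {section_value N p q t}"
  shows "line_subbundle O_plus_O1 F" "subbundle_degree O_plus_O1 F = 1 - int N"
proof -
  let ?r = "vector [p, q] :: complex poly ^ 2"
  let ?s = "vector [reverse_poly (N - 1) p, reverse_poly N q] :: complex poly ^ 2"
  have dp: "degree p \<le> N - 1" "degree q \<le> N" and p0: "N = 0 \<Longrightarrow> p = 0"
    using pq by (auto simp: sections_def)
  have r: "poly_vec ?r z = section_value N p q (Fin z)" for z
    by (simp add: poly_vec_def vec2_eq_iff)
  have s0: "poly_vec ?s 0 = section_value N p q Infty"
    using dp by (simp add: poly_vec_def vec2_eq_iff poly_reverse_poly_0)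
  have tr: "O_plus_O1 z *v poly_vec ?s (1 / z) = (z powi (1 - int N)) *s section_value N p q (Fin z)"
    if "z \<noteq> 0" for z
  proof (cases "N = 0")
    \<comment> \<open>The truncated \<open>N - 1\<close> is not the form degree here, but
      \<open>p\<close> is zero and \<open>q\<close> is constant.\<close>
    case True
    then obtain e where "q = [:e:]" using dp degree_eq_zeroE by blast
    then show ?thesis using True p0
      by (simp add: O_plus_O1_mult poly_vec_def vec2_eq_iff reverse_poly_def)
  next
    case False
    then obtain m where m: "N = Suc m" using not0_implies_Suc by blast
    have "z powi (1 - int N) = 1 / z ^ m"
      using that by (simp add: m power_int_minus field_simps)
    then show ?thesis using that dp
      by (simp add: m O_plus_O1_mult poly_vec_def vec2_eq_iff poly_reverse_poly power_one_over)
  qed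
  have s_nz: "poly_vec ?s w \<noteq> 0" for w
  proof (cases "w = 0")
    case True
    then show ?thesis using s0 nz by metis
  next
    case False
    show ?thesis
    proof
      assume "poly_vec ?s w = 0"
      with tr[of "1 / w"] False have "((1 / w) powi (1 - int N)) *s section_value N p q (Fin (1 / w)) = 0"
        by (simp add: matrix_vector_mult_0_right)
      then show False using False nz[of "Fin (1 / w)"] by (simp del: section_value.simps)
    qed
  qed
  have "subbundle_frames O_plus_O1 F ?r ?s"
    unfolding subbundle_frames_def
  proof (intro conjI allI impI)
    fix w :: complex assume "w \<noteq> 0"
    with tr[of "1 / w"] have "O_plus_O1 (1 / w) *v poly_vec ?s w
        = ((1 / w) powi (1 - int N)) *s section_value N p q (Fin (1 / w))" by simp
    then show "F (Fin (1 / w)) = vec.span {O_plus_O1 (1 / w) *v poly_vec ?s w}"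
      unfolding F_def using span_singleton_scale \<open>w \<noteq> 0\<close> by (simp del: section_value.simps)
  qed (use r s0 nz s_nz in \<open>simp_all add: F_def del: section_value.simps\<close>)
  then have T: "subbundle_transition O_plus_O1 F (\<lambda>z. z powi (1 - int N))"
    unfolding subbundle_transition_def using tr r by metis
  then show "line_subbundle O_plus_O1 F"
    unfolding line_subbundle_def subbundle_transition_def by blast
  show "subbundle_degree O_plus_O1 F = 1 - int N"
    unfolding subbundle_degree_eq[OF rank2_bundle_direct_sum T]
    by (rule line_degree_eqI[of 1]) auto
qed

text \<open>As \<open>z\<close> tends to infinity, \<open>poly r (1 / z)\<close> stays bounded,
  while the right-hand side grows like \<open>z\<close> to the power \<open>degree p + d\<close>.
  The proof compares degrees after clearing denominators, with \<open>d\<close> split into its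
  positive part \<open>a\<close> and negative part \<open>b\<close>.\<close>

lemma degree_reversal_bound:
  fixes p r :: "complex poly"
  assumes "p \<noteq> 0" "c \<noteq> 0"
    and eq: "\<And>z. z \<noteq> 0 \<Longrightarrow> poly r (1 / z) = c * z powi d * poly p z"
  shows "int (degree p) + d \<le> 0"
proof -
  define m a b where "m = degree r" and "a = nat d" and "b = nat (- d)"
  have d: "d = int a - int b" by (simp add: a_def b_def)
  have "monom 1 b * reflect_poly r = smult c (monom 1 (a + m) * p)"
  proof (rule poly_eqI_nonzero)
    fix z :: complex assume z: "z \<noteq> 0"
    have "poly (reflect_poly r) z = z ^ m * (c * z powi d * poly p z)"
      using z eq[OF z] by (simp add: poly_reflect_poly_nz m_def inverse_eq_divide)
    moreover have "z powi d = z ^ a / z ^ b" using z by (simp add: d power_int_diff)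
    ultimately show "poly (monom 1 b * reflect_poly r) z = poly (smult c (monom 1 (a + m) * p)) z"
      using z by (simp add: poly_monom power_add)
  qed
  moreover have "degree (smult c (monom 1 (a + m) * p)) = a + m + degree p"
    using assms by (simp add: degree_mult_eq degree_monom_eq)
  moreover have "degree (monom 1 b * reflect_poly r) \<le> b + m"
    using degree_mult_le[of "monom 1 b" "reflect_poly r"] degree_reflect_poly_le[of r]
    by (simp add: degree_monom_eq m_def)
  ultimately have "a + m + degree p \<le> b + m" by metis
  then show ?thesis using d by linarith
qed

text \<open>The frame over the \<open>z\<close>-line is already the required pair. Polynomiality of
  the frame over the \<open>w\<close>-line bounds the degrees of \<open>p\<close> and
  \<open>q\<close>, and with them the degree of the subbundle.\<close>

lemma subbundle_section:
  assumes F: "line_subbundle O_plus_O1 F"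
  obtains N p q where "(p, q) \<in> sections N" "\<And>t. F t = vec.span {section_value N p q t}"
    "subbundle_degree O_plus_O1 F = 1 - int N"
proof -
  obtain g where g: "subbundle_transition O_plus_O1 F g"
    using subbundle_transition_exists[OF rank2_bundle_direct_sum F] by blast
  obtain c d where c: "c \<noteq> 0" and gd: "\<And>z. z \<noteq> 0 \<Longrightarrow> g z = c * z powi d"
    using line_bundle_monomial[OF subbundle_transition_line_bundle[OF rank2_bundle_direct_sum g]] by blast
  have deg: "subbundle_degree O_plus_O1 F = d"
    unfolding subbundle_degree_eq[OF rank2_bundle_direct_sum g] using c gd by (rule line_degree_eqI)
  obtain r s where rs: "subbundle_frames O_plus_O1 F r s"
    and tr: "\<And>z. z \<noteq> 0 \<Longrightarrow> O_plus_O1 z *v poly_vec s (1 / z) = g z *s poly_vec r z"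
    using g unfolding subbundle_transition_def by blast
  define p q where "p = r $ 1" and "q = r $ 2"
  have eq1: "poly (s $ 1) (1 / z) = c * z powi d * poly p z" if "z \<noteq> 0" for z
    using tr[OF that] gd[OF that]
    by (simp add: O_plus_O1_mult poly_vec_def vec2_eq_iff p_def)
  have eq2: "poly (s $ 2) (1 / z) = c * z powi (d - 1) * poly q z" if "z \<noteq> 0" for z
    using tr[OF that] gd[OF that] that
    by (simp add: O_plus_O1_mult poly_vec_def vec2_eq_iff q_def power_int_diff field_simps)
  have dp: "p \<noteq> 0 \<Longrightarrow> int (degree p) + d \<le> 0"
    using degree_reversal_bound[OF _ c eq1] by blast
  have dq: "q \<noteq> 0 \<Longrightarrow> int (degree q) + d \<le> 1"
    using degree_reversal_bound[OF _ c eq2] by fastforce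
  have "p \<noteq> 0 \<or> q \<noteq> 0"
  proof -
    have "poly_vec r 0 \<noteq> 0" using rs unfolding subbundle_frames_def by blast
    then show ?thesis by (auto simp: poly_vec_def vec2_eq_iff p_def q_def)
  qed
  then have d1: "d \<le> 1" using dp dq by fastforce
  define N where "N = nat (1 - d)"
  have dN: "d = 1 - int N" using d1 by (simp add: N_def)
  have pq: "(p, q) \<in> sections N"
    using dp dq unfolding sections_def dN by fastforce
  have deg_le: "degree p \<le> N - 1" "degree q \<le> N" and p0: "N = 0 \<Longrightarrow> p = 0"
    using pq by (auto simp: sections_def)
  \<comment> \<open>Off \<open>w = 0\<close> the second frame is \<open>c\<close> times the reversed
    pair; being polynomial, the two also agree at 0, which identifies the fibre over
    \<open>Infty\<close>.\<close>
  have "s $ 1 = smult c (reverse_poly (N - 1) p)"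
  proof (rule poly_eqI_nonzero)
    fix w :: complex assume w: "w \<noteq> 0"
    show "poly (s $ 1) w = poly (smult c (reverse_poly (N - 1) p)) w"
    proof (cases "N = 0")
      case True
      then show ?thesis using eq1[of "1 / w"] w p0 by (simp add: reverse_poly_def)
    next
      case False
      then obtain m where "N = Suc m" using not0_implies_Suc by blast
      then show ?thesis using eq1[of "1 / w"] w deg_le
        by (simp add: dN poly_reverse_poly power_int_minus power_one_over)
    qed
  qed
  moreover have "s $ 2 = smult c (reverse_poly N q)"
  proof (rule poly_eqI_nonzero)
    fix w :: complex assume w: "w \<noteq> 0"
    show "poly (s $ 2) w = poly (smult c (reverse_poly N q)) w"
      using eq2[of "1 / w"] w deg_le
      by (simp add: dN poly_reverse_poly power_int_minus power_one_over)
  qed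
  ultimately have s0: "poly_vec s 0 = c *s section_value N p q Infty"
    using deg_le by (simp add: poly_vec_def vec2_eq_iff poly_reverse_poly_0)
  have r: "poly_vec r z = section_value N p q (Fin z)" for z
    by (simp add: poly_vec_def vec2_eq_iff p_def q_def)
  have "F t = vec.span {section_value N p q t}" for t
  proof (cases t)
    case (Fin z)
    then show ?thesis using rs r unfolding subbundle_frames_def by simp
  next
    case Infty
    then show ?thesis using rs s0 span_singleton_scale[OF c] unfolding subbundle_frames_def by simp
  qed
  then show thesis using that pq deg dN by blast
qed

section \<open>Subbundles with prescribed incidences\<close>

lemma lines_span:
  assumes "L \<in> lines" "w \<in> L" "w \<noteq> 0"
  shows "vec.span {w} = L"
proof -
  have L: "vec.subspace L" "vec.dim L = 1" using assms(1) by (auto simp: lines_def)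
  have "vec.span {w} \<subseteq> L" using L(1) assms(2) by (simp add: vec.span_minimal)
  moreover have "vec.dim (vec.span {w}) = vec.dim L" using L(2) assms(3) by simp
  ultimately show ?thesis
    using vec.subspace_dim_equal[OF vec.subspace_span L(1)] by auto
qed

lemma span_in_lines: "v \<noteq> 0 \<Longrightarrow> vec.span {v} \<in> lines"
  by (simp add: lines_def vec.subspace_span)

lemma lines_generator:
  assumes "L \<in> lines"
  obtains v where "v \<noteq> 0" "L = vec.span {v}"
proof -
  have "\<not> L \<subseteq> {0}"
    using assms vec.dim_subset[of L "{0}"] by (auto simp: lines_def)
  then show thesis using that lines_span[OF assms] by blast
qed

text \<open>The form is the determinant against a generator of the line.\<close>

lemma lines_linear_form:
  assumes "L \<in> lines"
  obtains a b where "\<And>w. a * w $ 1 + b * w $ 2 = 0 \<Longrightarrow> w \<in> L"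
proof -
  obtain v where v: "v \<noteq> 0" "L = vec.span {v}" using lines_generator[OF assms] by blast
  have "w \<in> L" if "- (v $ 2) * w $ 1 + v $ 1 * w $ 2 = 0" for w
  proof (cases "v $ 1 = 0")
    case True
    then have "v $ 2 \<noteq> 0" using v(1) by (auto simp: vec2_eq_iff)
    then have "w = (w $ 2 / v $ 2) *s v" using True that by (simp add: vec2_eq_iff)
    then show ?thesis unfolding v(2) vec.span_singleton by blast
  next
    case False
    then have "w = (w $ 1 / v $ 1) *s v" using that by (simp add: vec2_eq_iff field_simps)
    then show ?thesis unfolding v(2) vec.span_singleton by blast
  qed
  then show thesis by (rule that)
qed

text \<open>Both forms are divided by the linear form vanishing at \<open>x\<close>, which is
  nonzero at every other point. For \<open>x = Infty\<close> this form is 1 in the coordinate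
  \<open>z\<close>, so \<open>p\<close> and \<open>q\<close> stay the same and only \<open>N\<close>
  drops.\<close>

lemma section_divide:
  assumes pq: "(p, q) \<in> sections N" "(p, q) \<noteq> (0, 0)" and x: "section_value N p q x = 0"
  obtains M p' q' where "N = Suc M" "(p', q') \<in> sections M" "(p', q') \<noteq> (0, 0)"
    "\<And>y. y \<noteq> x \<Longrightarrow> \<exists>c. c \<noteq> 0 \<and> section_value N p q y = c *s section_value M p' q' y"
proof (cases x)
  case (Fin z)
  have "poly p z = 0" "poly q z = 0" using x Fin by (auto simp: vec2_eq_iff)
  then obtain p' q' where p': "p = [:- z, 1:] * p'" and q': "q = [:- z, 1:] * q'"
    unfolding poly_eq_0_iff_dvd dvd_def by blast
  have dp: "degree p = Suc (degree p')" if "p' \<noteq> 0"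
    unfolding p' using that by (subst degree_mult_eq) auto
  have dq: "degree q = Suc (degree q')" if "q' \<noteq> 0"
    unfolding q' using that by (subst degree_mult_eq) auto
  have nz: "(p', q') \<noteq> (0, 0)" using pq(2) p' q' by auto
  have "N \<noteq> 0" using nz dp dq pq(1) p' by (auto simp: sections_def)
  then obtain M where M: "N = Suc M" using not0_implies_Suc by blast
  have pq': "(p', q') \<in> sections M"
    using pq(1) dp dq p' unfolding M sections_def by fastforce
  have cp: "coeff p' M = 0" "coeff q' (Suc M) = 0"
    using pq' coeff_eq_0[of p' M] coeff_eq_0[of q' "Suc M"] by (auto simp: sections_def)
  \<comment> \<open>The top coefficient survives since the factor \<open>X - z\<close> is monic. For
    \<open>M = 0\<close> the truncated \<open>M - 1\<close> is harmless because \<open>p'\<close> is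
    zero.\<close>
  have "coeff p M = coeff p' (M - 1)"
    using cp(1) pq' by (cases M) (auto simp: p' sections_def)
  moreover have "coeff q (Suc M) = coeff q' M"
    using cp(2) by (simp add: q')
  ultimately have "section_value N p q Infty = 1 *s section_value M p' q' Infty"
    by (simp add: M vec2_eq_iff)
  moreover have "section_value N p q (Fin y) = (y - z) *s section_value M p' q' (Fin y)" for y
    by (simp add: p' q' vec2_eq_iff algebra_simps)
  ultimately have "\<exists>c. c \<noteq> 0 \<and> section_value N p q y = c *s section_value M p' q' y" if "y \<noteq> x" for y
    using that Fin by (cases y) (metis right_minus_eq, metis zero_neq_one)
  then show thesis using that M pq' nz by blast
next
  case Infty
  have lead: "coeff p (N - 1) = 0" "coeff q N = 0" using x Infty by (auto simp: vec2_eq_iff)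
  have "q = 0" if "N = 0" using that lead(2) pq(1) by (auto simp: sections_def elim: degree_eq_zeroE)
  then have "N \<noteq> 0" using pq by (auto simp: sections_def)
  then obtain M where M: "N = Suc M" using not0_implies_Suc by blast
  have "degree p < M \<or> p = 0"
    using pq(1) lead(1) leading_coeff_0_iff[of p] unfolding M sections_def
    by (cases "degree p = M") auto
  moreover have "degree q \<le> M"
    using pq(1) lead(2) leading_coeff_0_iff[of q] unfolding M sections_def
    by (cases "degree q = Suc M") auto
  ultimately have "(p, q) \<in> sections M" by (auto simp: sections_def)
  moreover have "\<exists>c. c \<noteq> 0 \<and> section_value N p q y = c *s section_value M p q y" if "y \<noteq> x" for y
    using that Infty by (cases y) (auto intro!: exI[of _ 1])
  ultimately show thesis using that M pq(2) by blast
qed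

section \<open>Scores of incidence sets and saturation\<close>

definition score :: "(4 \<Rightarrow> real) \<Rightarrow> 4 set \<Rightarrow> real" where
  "score \<epsilon> I = (\<Sum>i\<in>UNIV. if i \<in> I then \<epsilon> i else - \<epsilon> i)"

lemma score_mono:
  assumes "I \<subseteq> J" "\<And>i. 0 \<le> \<epsilon> i"
  shows "score \<epsilon> I \<le> score \<epsilon> J"
proof -
  have "- \<epsilon> i \<le> \<epsilon> i" for i using assms(2)[of i] by linarith
  then show ?thesis unfolding score_def using assms(1) by (intro sum_mono) auto
qed

lemma score_insert_le:
  assumes "0 \<le> \<epsilon> k"
  shows "score \<epsilon> (insert k I) \<le> score \<epsilon> I + 2 * \<epsilon> k"
proof -
  have "score \<epsilon> (insert k I) \<le> (\<Sum>i\<in>UNIV. (if i \<in> I then \<epsilon> i else - \<epsilon> i) + (if i = k then 2 * \<epsilon> k else 0))"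
    unfolding score_def using assms by (intro sum_mono) auto
  also have "\<dots> = score \<epsilon> I + 2 * \<epsilon> k" by (simp add: score_def sum.distrib)
  finally show ?thesis .
qed

text \<open>Zeros are divided out one at a time. At a zero the incidence holds trivially, because 0
  lies in every line, so it may get lost; injectivity of \<open>t\<close> limits the loss to one
  index per division. A nonzero value lying in \<open>P i\<close> spans it.\<close>

lemma section_saturation:
  assumes t: "inj t" and \<epsilon>: "\<And>i. 0 < \<epsilon> i" "\<And>i. \<epsilon> i < 1 / 2" and P: "\<And>i. P i \<in> lines"
    and "(p, q) \<in> sections N" "(p, q) \<noteq> (0, 0)"
  shows "\<exists>F. line_subbundle O_plus_O1 F \<and>
    1 - real N + score \<epsilon> {i. section_value N p q (t i) \<in> P i}
      \<le> subbundle_degree O_plus_O1 F + score \<epsilon> {i. F (t i) = P i}"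
  using assms(5,6)
proof (induction N arbitrary: p q)
  case (0 p q)
  have nz: "section_value 0 p q x \<noteq> 0" for x
    using section_divide[OF 0] by (metis nat.distinct(1))
  show ?case
    using section_subbundle[OF 0(1) nz] lines_span[OF P _ nz]
    by (intro exI[of _ "\<lambda>x. vec.span {section_value 0 p q x}"])
      (auto intro!: score_mono less_imp_le[OF \<epsilon>(1)])
next
  case (Suc N p q)
  show ?case
  proof (cases "\<exists>x. section_value (Suc N) p q x = 0")
    case True
    then obtain x where x: "section_value (Suc N) p q x = 0" by blast
    obtain p' q' where pq': "(p', q') \<in> sections N" "(p', q') \<noteq> (0, 0)"
      and eq: "\<And>y. y \<noteq> x \<Longrightarrow> \<exists>c. c \<noteq> 0 \<and> section_value (Suc N) p q y = c *s section_value N p' q' y"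
      using section_divide[OF Suc.prems x] by (metis Suc_inject)
    let ?I = "{i. section_value (Suc N) p q (t i) \<in> P i}"
    let ?J = "{i. section_value N p' q' (t i) \<in> P i}"
    have mem: "i \<in> ?J" if "i \<in> ?I" "t i \<noteq> x" for i
    proof -
      obtain c where c: "c \<noteq> 0" "section_value (Suc N) p q (t i) = c *s section_value N p' q' (t i)"
        using eq[OF \<open>t i \<noteq> x\<close>] by blast
      then have "section_value N p' q' (t i) = inverse c *s section_value (Suc N) p q (t i)" by simp
      moreover have "vec.subspace (P i)" using P by (auto simp: lines_def)
      ultimately show ?thesis using that by (metis mem_Collect_eq vec.subspace_scale)
    qed
    have "score \<epsilon> ?I \<le> score \<epsilon> ?J + 1"
    proof (cases "\<exists>k. t k = x")
      case True
      then obtain k where "t k = x" by blast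
      then have "?I \<subseteq> insert k ?J" using mem t by (auto simp: inj_def)
      then have "score \<epsilon> ?I \<le> score \<epsilon> (insert k ?J)" by (rule score_mono) (use \<epsilon> less_imp_le in blast)
      also have "\<dots> \<le> score \<epsilon> ?J + 2 * \<epsilon> k" using score_insert_le \<epsilon>(1)[of k] by simp
      finally show ?thesis using \<epsilon>(2)[of k] by linarith
    next
      case False
      then have "?I \<subseteq> ?J" using mem by auto
      then have "score \<epsilon> ?I \<le> score \<epsilon> ?J" by (rule score_mono) (use \<epsilon> less_imp_le in blast)
      then show ?thesis by simp
    qed
    then show ?thesis using Suc.IH[OF pq'] by fastforce
  next
    case False
    then have nz: "section_value (Suc N) p q x \<noteq> 0" for x by blast
    show ?thesis
      using section_subbundle[OF Suc.prems(1) nz] lines_span[OF P _ nz]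
      by (intro exI[of _ "\<lambda>x. vec.span {section_value (Suc N) p q x}"])
        (auto intro!: score_mono less_imp_le[OF \<epsilon>(1)] simp del: section_value.simps)
  qed
qed

section \<open>Linear systems and sections through prescribed lines\<close>

lemma homogeneous_system_solution:
  fixes A :: "'i \<Rightarrow> 'j \<Rightarrow> 'a::field"
  assumes "finite I" "finite J" "card I < card J"
  shows "\<exists>x. (\<exists>j\<in>J. x j \<noteq> 0) \<and> (\<forall>i\<in>I. (\<Sum>j\<in>J. A i j * x j) = 0)"
  using assms
proof (induction I arbitrary: J A rule: finite_induct)
  case empty
  then show ?case by (intro exI[of _ "\<lambda>_. 1"]) (auto simp: card_gt_0_iff)
next
  case (insert i I)
  show ?case
  proof (cases "\<forall>j\<in>J. A i j = 0")
    case True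
    then show ?thesis using insert.IH[of J A] insert.prems insert.hyps by auto
  next
    case False
    then obtain k where k: "k \<in> J" "A i k \<noteq> 0" by blast
    \<comment> \<open>Gaussian elimination with pivot \<open>A i k\<close>: a multiple of row
      \<open>i\<close> clears column \<open>k\<close> in the other rows.\<close>
    let ?B = "\<lambda>i' j. A i' j - A i' k / A i k * A i j"
    have "card I < card (J - {k})" using insert.prems insert.hyps k by simp
    then obtain x where x: "\<exists>j\<in>J - {k}. x j \<noteq> 0"
      "\<And>i'. i' \<in> I \<Longrightarrow> (\<Sum>j\<in>J - {k}. ?B i' j * x j) = 0"
      using insert.IH[of "J - {k}" ?B] insert.prems(1) by auto
    define s where "s = (\<Sum>j\<in>J - {k}. A i j * x j)"
    \<comment> \<open>The unknown \<open>k\<close> is chosen so that equation \<open>i\<close>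
      holds.\<close>
    define y where "y = x(k := - s / A i k)"
    have y: "(\<Sum>j\<in>J. A i' j * y j) = (\<Sum>j\<in>J - {k}. A i' j * x j) - A i' k * s / A i k" for i'
    proof -
      have "(\<Sum>j\<in>J - {k}. A i' j * y j) = (\<Sum>j\<in>J - {k}. A i' j * x j)"
        by (rule sum.cong) (auto simp: y_def)
      then show ?thesis
        using sum.remove[OF insert.prems(1) k(1), of "\<lambda>j. A i' j * y j"] by (simp add: y_def)
    qed
    have "(\<Sum>j\<in>J. A i' j * y j) = 0" if "i' \<in> I" for i'
    proof -
      have "(\<Sum>j\<in>J - {k}. ?B i' j * x j) = (\<Sum>j\<in>J - {k}. A i' j * x j) - A i' k / A i k * s"
        unfolding s_def by (simp add: sum_distrib_left sum_subtractf left_diff_distrib mult.assoc)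
      then show ?thesis using x(2)[OF that] by (simp add: y)
    qed
    moreover have "(\<Sum>j\<in>J. A i j * y j) = 0" using k by (simp add: y s_def)
    moreover have "\<exists>j\<in>J. y j \<noteq> 0" using x(1) by (auto simp: y_def)
    ultimately show ?thesis by blast
  qed
qed

text \<open>The unknowns are the \<open>2 N + 1\<close> coefficients of the two forms; each line
  imposes one linear equation.\<close>

lemma sections_through:
  fixes t :: "'i \<Rightarrow> cp1"
  assumes I: "finite I" "card I \<le> 2 * N" and P: "\<And>i. P i \<in> lines"
  obtains p q where "(p, q) \<in> sections N" "(p, q) \<noteq> (0, 0)"
    "\<And>i. i \<in> I \<Longrightarrow> section_value N p q (t i) \<in> P i"
proof -
  have "\<forall>i. \<exists>a b. \<forall>w. a * w $ 1 + b * w $ 2 = 0 \<longrightarrow> w \<in> P i"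
    using lines_linear_form[OF P] by metis
  then obtain a b where ab: "\<And>i w. a i * w $ 1 + b i * w $ 2 = 0 \<Longrightarrow> w \<in> P i" by metis
  \<comment> \<open>\<open>e n x k\<close> is the value at \<open>x\<close> of the
    \<open>k\<close>-th monomial, read as a form of degree \<open>n\<close>; at \<open>Infty\<close>
    only the top monomial survives.\<close>
  define e where "e n x k = (case x of Fin z \<Rightarrow> z ^ k | Infty \<Rightarrow> of_bool (k = n))" for n x and k :: nat
  define A where "A i = case_sum (\<lambda>k. a i * e (N - 1) (t i) k) (\<lambda>k. b i * e N (t i) k)" for i
  define J where "J = {..<N} <+> {..<Suc N}"
  have "finite J" "card I < card J" using I by (simp_all add: J_def card_Plus)
  then obtain x where x: "\<exists>j\<in>J. x j \<noteq> 0" "\<And>i. i \<in> I \<Longrightarrow> (\<Sum>j\<in>J. A i j * x j) = 0"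
    using homogeneous_system_solution[OF I(1), of J A] by blast
  define p where "p = (\<Sum>k<N. monom (x (Inl k)) k)"
  define q where "q = (\<Sum>k<Suc N. monom (x (Inr k)) k)"
  have cp: "coeff p k = (if k < N then x (Inl k) else 0)" for k
    by (simp add: p_def coeff_sum)
  have cq: "coeff q k = (if k < Suc N then x (Inr k) else 0)" for k
    unfolding q_def coeff_sum coeff_monom by (simp only: sum.delta finite_lessThan lessThan_iff)
  have v1: "section_value N p q y $ 1 = (\<Sum>k<N. x (Inl k) * e (N - 1) y k)" for y
    by (cases y)
      (auto simp: cp e_def of_bool_def if_distrib[of "\<lambda>u. _ * u"] cong: if_cong,
        simp add: p_def poly_sum poly_monom)
  have v2: "section_value N p q y $ 2 = (\<Sum>k<Suc N. x (Inr k) * e N y k)" for y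
    by (cases y)
      (auto simp: cq e_def of_bool_def if_distrib[of "\<lambda>u. _ * u"]
          simp del: sum.lessThan_Suc cong: if_cong,
        simp add: q_def poly_sum poly_monom)
  have "degree p < N" if "p \<noteq> 0"
    using that cp by (metis leading_coeff_0_iff)
  moreover have "degree q \<le> N"
    using cq by (intro degree_le) auto
  ultimately have "(p, q) \<in> sections N" by (auto simp: sections_def)
  moreover have "(p, q) \<noteq> (0, 0)"
  proof -
    obtain j where j: "j \<in> J" "x j \<noteq> 0" using x(1) by blast
    show ?thesis
    proof (cases j)
      case (Inl k)
      then have "coeff p k \<noteq> 0" using j by (auto simp: J_def cp)
      then show ?thesis by auto
    next
      case (Inr k)
      then have "coeff q k \<noteq> 0" using j by (auto simp: J_def cq)
      then show ?thesis by auto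
    qed
  qed
  moreover have "section_value N p q (t i) \<in> P i" if "i \<in> I" for i
  proof (rule ab)
    have "(\<Sum>j\<in>J. A i j * x j)
      = (\<Sum>k<N. a i * e (N - 1) (t i) k * x (Inl k)) + (\<Sum>k<Suc N. b i * e N (t i) k * x (Inr k))"
      unfolding J_def by (subst sum.Plus) (simp_all add: A_def)
    also have "\<dots> = a i * section_value N p q (t i) $ 1 + b i * section_value N p q (t i) $ 2"
      unfolding v1 v2 sum_distrib_left by (simp only: ac_simps)
    finally show "a i * section_value N p q (t i) $ 1 + b i * section_value N p q (t i) $ 2 = 0"
      using x(2)[OF that] by simp
  qed
  ultimately show thesis by (rule that)
qed

section \<open>Stability in terms of the score\<close>

text \<open>The two weights at \<open>i\<close> differ from their mean by plus and minus
  \<open>\<epsilon> i\<close>. They enter with a minus sign, so an incidence, which selects the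
  smaller weight, contributes \<open>+ \<epsilon> i\<close>.\<close>

lemma sub_pardeg_minus_slope:
  assumes "\<And>i. \<epsilon> i = (\<alpha> i Plus - \<alpha> i Minus) / 2"
  shows "sub_pardeg \<alpha> t O_plus_O1 P F - pardeg \<alpha> O_plus_O1 / 2
    = subbundle_degree O_plus_O1 F - 1 / 2 + score \<epsilon> {i. F (t i) = P i}"
proof -
  have "(\<Sum>i\<in>UNIV. \<alpha> i Plus + \<alpha> i Minus) / 2 - (\<Sum>i\<in>UNIV. \<alpha> i (incidence_sign t P F i))
      = (\<Sum>i\<in>UNIV. (\<alpha> i Plus + \<alpha> i Minus) / 2 - \<alpha> i (incidence_sign t P F i))"
    by (simp add: sum_subtractf sum_divide_distrib)
  also have "\<dots> = score \<epsilon> {i. F (t i) = P i}"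
    unfolding score_def by (rule sum.cong) (auto simp: assms incidence_sign_def field_simps)
  finally show ?thesis
    by (simp add: sub_pardeg_def pardeg_def bundle_degree_direct_sum diff_divide_distrib)
qed

text \<open>Taking the sign \<open>Plus\<close> exactly on \<open>I\<close> turns the nonspeciality
  expression into the score plus 1/2. This rules out equality in the stability inequalities.\<close>

lemma nonspecial_score:
  assumes "nonspecial 1 \<alpha>" "\<And>i. \<epsilon> i = (\<alpha> i Plus - \<alpha> i Minus) / 2"
  shows "score \<epsilon> I + 1 / 2 \<notin> \<int>"
proof -
  let ?\<sigma> = "\<lambda>i. if i \<in> I then Plus else Minus"
  have "(\<Sum>i\<in>UNIV. \<alpha> i (?\<sigma> i)) - (\<Sum>i\<in>UNIV. \<alpha> i Plus + \<alpha> i Minus) / 2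
      = (\<Sum>i\<in>UNIV. \<alpha> i (?\<sigma> i) - (\<alpha> i Plus + \<alpha> i Minus) / 2)"
    by (simp add: sum_subtractf sum_divide_distrib)
  also have "\<dots> = score \<epsilon> I"
    unfolding score_def by (rule sum.cong) (auto simp: assms(2) field_simps)
  finally have "(\<Sum>i\<in>UNIV. \<alpha> i (?\<sigma> i)) + (real_of_int 1 - (\<Sum>i\<in>UNIV. \<alpha> i Plus + \<alpha> i Minus)) / 2
      = score \<epsilon> I + 1 / 2" by (simp add: diff_divide_distrib)
  moreover have "(\<Sum>i\<in>UNIV. \<alpha> i (?\<sigma> i))
      + (real_of_int 1 - (\<Sum>i\<in>UNIV. \<alpha> i Plus + \<alpha> i Minus)) / 2 \<notin> \<int>"
    using assms(1)[unfolded nonspecial_def, THEN conjunct2, THEN spec, of ?\<sigma>] .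
  ultimately show ?thesis by simp
qed

lemma unstable_if_score:
  assumes t: "inj t" and \<alpha>: "nonspecial 1 \<alpha>"
    and \<epsilon>: "\<And>i. \<epsilon> i = (\<alpha> i Plus - \<alpha> i Minus) / 2"
    and P: "P \<in> parabolic_structures"
    and I: "card I \<le> 2 * N" "1 - real N + score \<epsilon> I > 1 / 2"
  shows "parabolic_unstable \<alpha> t O_plus_O1 P"
proof -
  have P': "P i \<in> lines" for i using P by (simp add: parabolic_structures_def)
  have w: "\<alpha> i Minus < \<alpha> i Plus \<and> \<alpha> i Plus < \<alpha> i Minus + 1" for i
    using \<alpha> unfolding nonspecial_def by blast
  have \<epsilon>_bounds: "0 < \<epsilon> i" "\<epsilon> i < 1 / 2" for i using w[of i] by (simp_all add: \<epsilon> field_simps)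
  obtain p q where pq: "(p, q) \<in> sections N" "(p, q) \<noteq> (0, 0)"
    and thr: "\<And>i. i \<in> I \<Longrightarrow> section_value N p q (t i) \<in> P i"
    by (rule sections_through[where P = P and t = t, OF finite I(1) P']) (rule that)
  obtain F where F: "line_subbundle O_plus_O1 F"
    "1 - real N + score \<epsilon> {i. section_value N p q (t i) \<in> P i}
      \<le> subbundle_degree O_plus_O1 F + score \<epsilon> {i. F (t i) = P i}"
    using section_saturation[of t \<epsilon> P p q N, OF t \<epsilon>_bounds P' pq] by blast
  \<comment> \<open>The section may meet further lines by accident, which can only raise the
    score.\<close>
  have "score \<epsilon> I \<le> score \<epsilon> {i. section_value N p q (t i) \<in> P i}"
    by (rule score_mono) (use thr \<epsilon>_bounds(1) less_imp_le in auto)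
  then have "sub_pardeg \<alpha> t O_plus_O1 P F > pardeg \<alpha> O_plus_O1 / 2"
    using sub_pardeg_minus_slope[of \<epsilon> \<alpha> t P F, OF \<epsilon>] F(2) I(2) by linarith
  then show ?thesis using F(1) unfolding parabolic_semistable_def by force
qed

section \<open>General parabolic structures\<close>

fun homog_x :: "cp1 \<Rightarrow> complex" where
  "homog_x (Fin z) = z"
| "homog_x Infty = 1"

fun homog_y :: "cp1 \<Rightarrow> complex" where
  "homog_y (Fin z) = 1"
| "homog_y Infty = 0"

text \<open>In homogeneous coordinates, so that \<open>Infty\<close> is on a par with the finite
  points; it vanishes exactly when the two points coincide.\<close>

definition bracket :: "cp1 \<Rightarrow> cp1 \<Rightarrow> complex" where
  "bracket a b = homog_x a * homog_y b - homog_x b * homog_y a"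

text \<open>
  Expansion of the determinant with rows \<open>(v i $ 2, v i $ 1 * x, v i $ 1 * y)\<close>, where \<open>(x : y)\<close> is
  \<open>t i\<close>, over three indices.  It vanishes if some degree \<open>0\<close> subbundle meets all three lines.
\<close>

definition triple_det :: "(4 \<Rightarrow> cp1) \<Rightarrow> 4 \<times> 4 \<times> 4 \<Rightarrow> (4 \<Rightarrow> complex ^ 2) \<Rightarrow> complex" where
  "triple_det t = (\<lambda>(i, j, k) v.
     bracket (t j) (t k) * (v i $ 2 * (v j $ 1 * v k $ 1))
     + (bracket (t k) (t i) * (v j $ 2 * (v k $ 1 * v i $ 1))
     + bracket (t i) (t j) * (v k $ 2 * (v i $ 1 * v j $ 1))))"

definition distinct_triples :: "(4 \<times> 4 \<times> 4) set" where
  "distinct_triples = {(i, j, k). i \<noteq> j \<and> i \<noteq> k \<and> j \<noteq> k}"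

text \<open>Nonvanishing on generators ensures that no \<open>P i\<close> is the fibre of the
  summand \<open>O(1)\<close>, the only subbundle of degree 1, and that no subbundle of degree 0
  meets three of the lines.\<close>

definition generic_poly :: "(4 \<Rightarrow> cp1) \<Rightarrow> (4 \<Rightarrow> complex ^ 2) \<Rightarrow> complex" where
  "generic_poly t v = (\<Prod>i\<in>UNIV. v i $ 1) * (\<Prod>m\<in>distinct_triples. triple_det t m v)"

lemma generic_poly_nonzero_iff:
  "generic_poly t v \<noteq> 0 \<longleftrightarrow>
    (\<forall>i. v i $ 1 \<noteq> 0) \<and> (\<forall>i j k. i \<noteq> j \<and> i \<noteq> k \<and> j \<noteq> k \<longrightarrow> triple_det t (i, j, k) v \<noteq> 0)"
  by (auto simp: generic_poly_def distinct_triples_def)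

lemma polynomial_fun_prod:
  "(\<And>m. m \<in> A \<Longrightarrow> polynomial_fun (f m)) \<Longrightarrow> polynomial_fun (\<lambda>v. \<Prod>m\<in>A. f m v)"
  by (induction A rule: infinite_finite_induct) (auto intro: polynomial_fun.intros)

lemma multihomogeneous_mult:
  assumes "multihomogeneous f" "multihomogeneous g"
  shows "multihomogeneous (\<lambda>v. f v * g v)"
proof -
  obtain d e where "\<And>c v. f (\<lambda>i. c i *s v i) = (\<Prod>i\<in>UNIV. c i ^ d i) * f v"
    "\<And>c v. g (\<lambda>i. c i *s v i) = (\<Prod>i\<in>UNIV. c i ^ e i) * g v"
    using assms unfolding multihomogeneous_def by metis
  then show ?thesis unfolding multihomogeneous_def
    by (intro exI[of _ "\<lambda>i. d i + e i"]) (simp add: power_add prod.distrib)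
qed

lemma multihomogeneous_prod:
  "(\<And>m. m \<in> A \<Longrightarrow> multihomogeneous (f m)) \<Longrightarrow> multihomogeneous (\<lambda>v. \<Prod>m\<in>A. f m v)"
proof (induction A rule: infinite_finite_induct)
  case (insert m A)
  then show ?case by (simp add: multihomogeneous_mult)
qed (auto simp: multihomogeneous_def intro!: exI[of _ "\<lambda>_. 0"])

lemma prod_power_indicator:
  fixes c :: "4 \<Rightarrow> complex"
  shows "(\<Prod>i\<in>UNIV. c i ^ (if i \<in> A then 1 else 0)) = (\<Prod>i\<in>A. c i)"
proof -
  have "(\<Prod>i\<in>UNIV. c i ^ (if i \<in> A then 1 else 0)) = (\<Prod>i\<in>UNIV. if i \<in> A then c i else 1)"
    by (rule prod.cong) auto
  also have "\<dots> = (\<Prod>i\<in>A. c i)" by (simp add: prod.If_cases)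
  finally show ?thesis .
qed

lemma generic_poly_polynomial: "polynomial_fun (generic_poly t)"
  unfolding generic_poly_def triple_det_def case_prod_unfold
  by (intro polynomial_fun.intros polynomial_fun_prod)

lemma generic_poly_multihomogeneous: "multihomogeneous (generic_poly t)"
  unfolding generic_poly_def
proof (intro multihomogeneous_mult multihomogeneous_prod)
  fix i :: 4
  show "multihomogeneous (\<lambda>v. v i $ 1)"
    unfolding multihomogeneous_def
    by (intro exI[of _ "\<lambda>m. if m \<in> {i} then 1 else 0"]) (simp only: prod_power_indicator, simp)
next
  fix m assume "m \<in> distinct_triples"
  then obtain i j k where m: "m = (i, j, k)" "i \<noteq> j" "i \<noteq> k" "j \<noteq> k"
    by (auto simp: distinct_triples_def)
  \<comment> \<open>Every term is linear in each of \<open>v i\<close>, \<open>v j\<close>,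
    \<open>v k\<close>, so the multidegree is the indicator of these indices.\<close>
  then show "multihomogeneous (triple_det t m)"
    unfolding multihomogeneous_def
    by (intro exI[of _ "\<lambda>m. if m \<in> {i, j, k} then 1 else 0"])
      (simp only: prod_power_indicator, simp add: triple_det_def algebra_simps)
qed

lemma generic_poly_nonzero_exists:
  assumes t: "inj t"
  shows "\<exists>v. generic_poly t v \<noteq> 0"
proof -
  \<comment> \<open>With \<open>v i = (1, z\<^sup>2)\<close> the determinants are of Vandermonde type; at \<open>Infty\<close> the second entry
    \<open>U\<close> has to avoid the sums of two coordinates.\<close>
  define S where "S = (\<lambda>(i, j). homog_x (t i) + homog_x (t j)) ` UNIV"
  obtain U where U: "U \<notin> S" using ex_new_if_finite[OF infinite_UNIV_char_0, of S] by (auto simp: S_def)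
  then have Uij: "U \<noteq> homog_x (t i) + homog_x (t j)" for i j by (auto simp: S_def)
  define u where "u x = (case x of Fin z \<Rightarrow> z ^ 2 | Infty \<Rightarrow> U)" for x
  define v where "v i = (vector [1, u (t i)] :: complex ^ 2)" for i
  have "triple_det t (i, j, k) v \<noteq> 0" if d: "i \<noteq> j" "i \<noteq> k" "j \<noteq> k" for i j k
  proof -
    have dt: "t i \<noteq> t j" "t i \<noteq> t k" "t j \<noteq> t k" using d t by (auto simp: inj_eq)
    have D: "triple_det t (i, j, k) v
        = bracket (t j) (t k) * u (t i) + bracket (t k) (t i) * u (t j) + bracket (t i) (t j) * u (t k)"
      by (simp add: triple_det_def v_def)
    \<comment> \<open>The three points are distinct, so at most one of them is
      \<open>Infty\<close>.\<close>
    consider a b c where "t i = Fin a" "t j = Fin b" "t k = Fin c"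
      | a b where "t i = Infty" "t j = Fin a" "t k = Fin b"
      | a b where "t i = Fin a" "t j = Infty" "t k = Fin b"
      | a b where "t i = Fin a" "t j = Fin b" "t k = Infty"
      using dt by (metis cp1.exhaust)
    then show ?thesis
    proof cases
      case (1 a b c)
      then have "triple_det t (i, j, k) v = (a - b) * (a - c) * (b - c)"
        by (simp add: D bracket_def u_def power2_eq_square algebra_simps)
      then show ?thesis using dt 1 by auto
    next
      case (2 a b)
      then have "triple_det t (i, j, k) v = (a - b) * (U - (a + b))"
        by (simp add: D bracket_def u_def power2_eq_square algebra_simps)
      then show ?thesis using dt 2 Uij[of j k] by auto
    next
      case (3 a b)
      then have "triple_det t (i, j, k) v = (b - a) * (U - (a + b))"
        by (simp add: D bracket_def u_def power2_eq_square algebra_simps)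
      then show ?thesis using dt 3 Uij[of i k] by auto
    next
      case (4 a b)
      then have "triple_det t (i, j, k) v = (a - b) * (U - (a + b))"
        by (simp add: D bracket_def u_def power2_eq_square algebra_simps)
      then show ?thesis using dt 4 Uij[of i j] by auto
    qed
  qed
  then show ?thesis using generic_poly_nonzero_iff[of t v] by (auto simp: v_def)
qed

text \<open>The open set is the complement of a single zero locus. A structure outside it has
  generators on which the polynomial is nonzero, so \<open>A\<close> may be proved from one such
  choice.\<close>

lemma holds_generally_if_generic_poly:
  assumes "inj t"
    and A: "\<And>P v. P \<in> parabolic_structures \<Longrightarrow> (\<And>i. v i \<in> P i) \<Longrightarrow> generic_poly t v \<noteq> 0 \<Longrightarrow> A P"
  shows "holds_generally A"
proof -
  let ?U = "parabolic_structures - zero_locus {generic_poly t}"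
  have "zariski_open ?U"
    unfolding zariski_open_def
    using generic_poly_polynomial generic_poly_multihomogeneous by blast
  moreover have "?U \<noteq> {}"
  proof -
    obtain v where v: "generic_poly t v \<noteq> 0" using generic_poly_nonzero_exists[OF assms(1)] by blast
    have "v i \<noteq> 0" for i using v unfolding generic_poly_nonzero_iff by (metis zero_index)
    then have "(\<lambda>i. vec.span {v i}) \<in> ?U"
      using v by (auto simp: parabolic_structures_def zero_locus_def span_in_lines intro!: exI[of _ v] vec.span_base)
    then show ?thesis by blast
  qed
  moreover have "A P" if "P \<in> ?U" for P
    using that A by (auto simp: zero_locus_def)
  ultimately show ?thesis unfolding holds_generally_def by blast
qed

text \<open>Homogeneous coordinates give one formula for finite points and \<open>Infty\<close>,
  matching the shape of \<open>triple_det\<close>.\<close>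

lemma section_degree_one_value:
  assumes "(p, q) \<in> sections 1"
  obtains c a b where
    "\<And>x. section_value 1 p q x = vector [c, a * homog_y x + b * homog_x x]"
proof -
  have "degree p = 0" "degree q \<le> 1" using assms by (auto simp: sections_def)
  then obtain c where p: "p = [:c:]" by (auto elim: degree_eq_zeroE)
  obtain a q' where "q = pCons a q'" by (cases q)
  moreover then have "degree q' = 0" using \<open>degree q \<le> 1\<close> by (cases "q' = 0") auto
  ultimately obtain b where q: "q = [:a, b:]" by (auto elim: degree_eq_zeroE)
  have "section_value 1 p q x = vector [c, a * homog_y x + b * homog_x x]" for x
    by (cases x) (simp_all add: p q vec2_eq_iff)
  then show thesis by (rule that)
qed

text \<open>In degree 1 the first form is zero, so an incidence would force
  \<open>v i $ 1 = 0\<close>. In degree 0 three incidences produce a linear relation between the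
  columns of the determinant \<open>triple_det\<close>.\<close>

lemma generic_incidence:
  assumes F: "line_subbundle O_plus_O1 F" and v: "\<And>i. v i \<in> P i" "generic_poly t v \<noteq> 0"
  shows "subbundle_degree O_plus_O1 F = 1 \<Longrightarrow> {i. F (t i) = P i} = {}"
    and "subbundle_degree O_plus_O1 F = 0 \<Longrightarrow> card {i. F (t i) = P i} \<le> 2"
    and "subbundle_degree O_plus_O1 F \<le> 1"
proof -
  obtain N p q where pq: "(p, q) \<in> sections N" and Fs: "\<And>t. F t = vec.span {section_value N p q t}"
    and deg: "subbundle_degree O_plus_O1 F = 1 - int N"
    using subbundle_section[OF F] by metis
  have v1: "v i $ 1 \<noteq> 0" for i using v(2) by (simp add: generic_poly_nonzero_iff)
  have mult: "\<exists>k. v i = k *s section_value N p q (t i)" if "F (t i) = P i" for i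
    using v(1)[of i] that Fs[of "t i"] by (auto simp: vec.span_singleton)
  show "subbundle_degree O_plus_O1 F \<le> 1" using deg by simp
  show "{i. F (t i) = P i} = {}" if "subbundle_degree O_plus_O1 F = 1"
  proof -
    have "N = 0" using that deg by simp
    then have "section_value N p q x $ 1 = 0" for x
      using pq by (cases x) (auto simp: sections_def)
    then have "v i $ 1 = 0" if "F (t i) = P i" for i
      using mult[OF that] by auto
    then show ?thesis using v1 by blast
  qed
  show "card {i. F (t i) = P i} \<le> 2" if "subbundle_degree O_plus_O1 F = 0"
  proof (rule ccontr)
    assume "\<not> card {i. F (t i) = P i} \<le> 2"
    then have "3 \<le> card {i. F (t i) = P i}" by simp
    then obtain T where "T \<subseteq> {i. F (t i) = P i}" "card T = 3"
      by (rule obtain_subset_with_card_n)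
    then obtain i j k where ijk: "i \<noteq> j" "i \<noteq> k" "j \<noteq> k"
      "F (t i) = P i" "F (t j) = P j" "F (t k) = P k"
      unfolding card_3_iff by auto
    have N: "N = 1" using that deg by simp
    obtain c a b where val: "\<And>x. section_value 1 p q x = vector [c, a * homog_y x + b * homog_x x]"
      using section_degree_one_value[OF pq[unfolded N]] by blast
    let ?w = "\<lambda>x. vector [c, a * homog_y x + b * homog_x x] :: complex ^ 2"
    obtain r s u where "v i = r *s ?w (t i)" "v j = s *s ?w (t j)" "v k = u *s ?w (t k)"
      using mult[OF ijk(4)] mult[OF ijk(5)] mult[OF ijk(6)] unfolding N val by blast
    \<comment> \<open>In each of the three rows, \<open>c\<close> times the first entry equals
      \<open>b\<close> times the second plus \<open>a\<close> times the third; if all three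
      coefficients vanish, so do the rows.\<close>
    then have "triple_det t (i, j, k) v = 0"
      by (simp add: triple_det_def bracket_def algebra_simps)
    then show False using v(2) ijk(1-3) by (simp add: generic_poly_nonzero_iff)
  qed
qed

section \<open>Pairs among the four indices\<close>

lemma score_pair:
  assumes "{i, j, k, l} = (UNIV :: 4 set)"
  shows "score \<epsilon> {i, j} = \<epsilon> i + \<epsilon> j - \<epsilon> k - \<epsilon> l"
proof -
  \<comment> \<open>Exhausting a four-element type forces the indices to be distinct, so the set
    equation does express a renumbering.\<close>
  have "card {i, j, k, l} = 4" using assms by simp
  then have d: "i \<noteq> j" "i \<noteq> k" "i \<noteq> l" "j \<noteq> k" "j \<noteq> l" "k \<noteq> l"
    by (auto simp: card_insert_if split: if_splits)
  then show ?thesis unfolding score_def assms[symmetric] by simp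
qed

text \<open>Enlarging an incidence set to a pair only raises its score, and pairs are what condition
  (c) speaks about.\<close>

lemma pair_cover:
  fixes I :: "4 set"
  assumes "card I \<le> 2"
  obtains i j k l where "I \<subseteq> {i, j}" "{i, j, k, l} = (UNIV :: 4 set)"
proof -
  obtain J where J: "I \<subseteq> J" "card J = 2"
    using exists_subset_between[OF assms, of UNIV] by auto
  have "card (- J) = 2" using J(2) by (simp add: Compl_eq_Diff_UNIV card_Diff_subset)
  then obtain i j k l where "J = {i, j}" "- J = {k, l}"
    using J(2) unfolding card_2_iff by metis
  then show thesis using that[of i j k l] J(1) Compl_partition[of J] by auto
qed

section \<open>Instability and generic stability\<close>

theorem proposition4p2:
  fixes t :: "4 \<Rightarrow> cp1"
    and \<alpha> :: weights
    and \<epsilon> :: "4 \<Rightarrow> real"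
    and B :: transition
  assumes "inj t"
    and "nonspecial 1 \<alpha>"
    and "\<And>i. \<epsilon> i = (\<alpha> i Plus - \<alpha> i Minus) / 2"
    and "B = direct_sum (O_line 0) (O_line 1)"
  shows
    "(\<epsilon> 1 + \<epsilon> 2 + \<epsilon> 3 + \<epsilon> 4 < 1 / 2 \<or>
      \<epsilon> 1 + \<epsilon> 2 + \<epsilon> 3 + \<epsilon> 4 > 3 / 2 \<or>
      (\<exists>i j k l. {i, j, k, l} = (UNIV :: 4 set) \<and> \<epsilon> i + \<epsilon> j - \<epsilon> k - \<epsilon> l > 1 / 2)
      \<longrightarrow> (\<forall>P\<in>parabolic_structures. parabolic_unstable \<alpha> t B P)) \<and>
     (\<not> (\<epsilon> 1 + \<epsilon> 2 + \<epsilon> 3 + \<epsilon> 4 < 1 / 2 \<or>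
         \<epsilon> 1 + \<epsilon> 2 + \<epsilon> 3 + \<epsilon> 4 > 3 / 2 \<or>
         (\<exists>i j k l. {i, j, k, l} = (UNIV :: 4 set) \<and> \<epsilon> i + \<epsilon> j - \<epsilon> k - \<epsilon> l > 1 / 2))
      \<longrightarrow> holds_generally (\<lambda>P. parabolic_stable \<alpha> t B P))"
proof -
  let ?s = "\<epsilon> 1 + \<epsilon> 2 + \<epsilon> 3 + \<epsilon> 4"
  have w: "\<alpha> i Minus < \<alpha> i Plus \<and> \<alpha> i Plus < \<alpha> i Minus + 1" for i
    using assms(2) unfolding nonspecial_def by blast
  have \<epsilon>: "0 < \<epsilon> i" "\<epsilon> i < 1 / 2" for i using w[of i] by (simp_all add: assms(3) field_simps)
  have score: "score \<epsilon> {} = - ?s" "score \<epsilon> UNIV = ?s" by (simp_all add: score_def sum_4)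
  show ?thesis
  proof (intro conjI impI ballI)
    fix P assume "P \<in> parabolic_structures"
    note unst = unstable_if_score[of t \<alpha> \<epsilon> P, OF assms(1-3) this, folded assms(4)]
    assume "?s < 1 / 2 \<or> ?s > 3 / 2 \<or>
      (\<exists>i j k l. {i, j, k, l} = (UNIV :: 4 set) \<and> \<epsilon> i + \<epsilon> j - \<epsilon> k - \<epsilon> l > 1 / 2)"
    then consider "?s < 1 / 2" | "?s > 3 / 2"
      | i j k l where "{i, j, k, l} = (UNIV :: 4 set)" "\<epsilon> i + \<epsilon> j - \<epsilon> k - \<epsilon> l > 1 / 2" by blast
    \<comment> \<open>In each case \<open>N\<close> is half the number of lines that the section is
      made to meet.\<close>
    then show "parabolic_unstable \<alpha> t B P"
    proof cases
      case 1
      then show ?thesis using unst[of "{}" 0] score(1) by simp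
    next
      case 2
      then show ?thesis using unst[of UNIV 2] score(2) by simp
    next
      case (3 i j k l)
      then show ?thesis using unst[of "{i, j}" 1] score_pair[OF 3(1), of \<epsilon>] by (simp add: card_insert_if)
    qed
  next
    assume H: "\<not> (?s < 1 / 2 \<or> ?s > 3 / 2 \<or>
      (\<exists>i j k l. {i, j, k, l} = (UNIV :: 4 set) \<and> \<epsilon> i + \<epsilon> j - \<epsilon> k - \<epsilon> l > 1 / 2))"
    \<comment> \<open>The negated conditions give only weak inequalities. Equality would mean a
      score of -1/2, 1/2 or 3/2 in degree 1, 0 or -1 respectively, and nonspeciality excludes these
      values.\<close>
    have ns: "score \<epsilon> I \<noteq> real_of_int n - 1 / 2" for I n
    proof
      assume "score \<epsilon> I = real_of_int n - 1 / 2"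
      then have "score \<epsilon> I + 1 / 2 = real_of_int n" by simp
      then show False using nonspecial_score[of \<alpha> \<epsilon> I, OF assms(2,3)] by (metis Ints_of_int)
    qed
    show "holds_generally (\<lambda>P. parabolic_stable \<alpha> t B P)"
    proof (rule holds_generally_if_generic_poly[OF assms(1)])
      fix P v assume v: "\<And>i. v i \<in> P i" "generic_poly t v \<noteq> 0"
      show "parabolic_stable \<alpha> t B P"
        unfolding parabolic_stable_def assms(4)
      proof (intro allI impI)
        fix F assume F: "line_subbundle O_plus_O1 F"
        define I d where "I = {i. F (t i) = P i}" and "d = subbundle_degree O_plus_O1 F"
        note gen = generic_incidence[OF F v, folded I_def d_def]
        have le: "score \<epsilon> I \<le> ?s"
          unfolding score(2)[symmetric] by (rule score_mono) (use \<epsilon>(1) less_imp_le in auto)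
        have "d + score \<epsilon> I < 1 / 2"
        proof -
          consider "d = 1" | "d = 0" | "d = -1" | "d \<le> -2" using gen(3) by linarith
          then show ?thesis
          proof cases
            case 1
            then show ?thesis using gen(1) score(1) H ns[of "{}" 0] by auto
          next
            case 2
            obtain i j k l where ij: "I \<subseteq> {i, j}" "{i, j, k, l} = (UNIV :: 4 set)"
              using pair_cover[OF gen(2)[OF 2]] by blast
            have "score \<epsilon> I \<le> score \<epsilon> {i, j}"
              by (rule score_mono[OF ij(1)]) (use \<epsilon>(1) less_imp_le in auto)
            moreover have "score \<epsilon> {i, j} \<le> 1 / 2"
              using H ij(2) unfolding score_pair[OF ij(2)] by (meson not_le)
            ultimately show ?thesis using ns[of "{i, j}" 1] 2 by simp
          next
            case 3
            \<comment> \<open>Even meeting all four lines is harmless here, since (b) fails.\<close>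
            then show ?thesis using le H ns[of UNIV 2] score(2) by auto
          next
            case 4
            then show ?thesis using le \<epsilon>(2)[of 1] \<epsilon>(2)[of 2] \<epsilon>(2)[of 3] \<epsilon>(2)[of 4] by linarith
          qed
        qed
        then show "sub_pardeg \<alpha> t O_plus_O1 P F < pardeg \<alpha> O_plus_O1 / 2"
          using sub_pardeg_minus_slope[of \<epsilon> \<alpha> t P F, OF assms(3)] unfolding I_def d_def by linarith
      qed
    qed
  qed
qed

end
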